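(* There is a bijection between associative (generalized) composition algebras and group spherical spaces, up to choice of base point. More precisely: (0) One direction: let $\mathbb{A}$ be an associative (generalized) composition algebra over $\mathbb{K}$ with scalar involution $\sharp$ and norm $N:\mathbb{A}\to\mathbb{K}$, defined by $xx^\sharp=N(x)1$. Then for any $\lambda\in\mathbb{K}^\times$, $V=\mathbb{A}$ with trilinear map $\langle xyz\rangle=\lambda\,xy^\sharp z$ is a group spherical space over $\mathbb{K}$, with quadratic form $q=\lambda N$. For the other direction, let $(V,q)$, with ternary product $\langle xyz\rangle$, be a group spherical space, and fix $e\in V^\times$. Then: \begin{enumerate} \item The bilinear product $xz:=x\cdot_e z=\frac{\langle xez\rangle}{q(e)}$ turns $V$ into an associative algebra with neutral element $e$, and with involution $\sharp=s_e=\frac{S_{e,e}}{q(e)}:V\to V$, $$x^\sharp=s_e(x)=\frac{\langle exe\rangle}{q(e)}=\frac{b_q(x,e)}{q(e)}e-x,$$ and this algebra is a composition algebra with respect to the norm $N(x):=\frac{q(x)}{q(e)}$. \item The construction from item 1 is inverse to the construction from (0): $\langle xyz\rangle=q(e)\,x\cdot y^\sharp\cdot z$. \item The algebra $(V,\cdot_e)$ is isomorphic to $\mathbf{C}_q^L$, via $V\to\mathbf{C}_q^L$, $v\mapsto L(v):=\frac{1}{q(e)}L_{v,e}$, with inverse $\mathbf{C}_q^L\to V$, $f\mapsto f(e)$. \item The algebra $(V,\cdot_e)$ is anti-isomorphic to $\mathbf{C}_q^R$, via $V\to\mathbf{C}_q^R$, $v\mapsto R(v):=\frac{1}{q(e)}R_{v,e}$,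 with inverse $\mathbf{C}_q^R\to V$, $f\mapsto f(e)$. \item The ternary composition law (TC) follows already from the Kirmse laws (K) and para-associativity (PA): [(K) and (PA)] $\Rightarrow$ (TC). \item Assume $\mathbb{K}$ is a field. Then $q$ is anisotropic if and only if $(V,\cdot_e,e)$ is a skew-field. \end{enumerate}
   Context: $\mathbb{K}$ is a commutative ring with unit ($2$ not assumed invertible). A quadratic space $(V,q)$ is a $\mathbb{K}$-module $V$ with a map $q:V\to\mathbb{K}$ such that $q(\lambda v)=\lambda^2q(v)$ and $b_q(u,v)=q(u+v)-q(u)-q(v)$ is $\mathbb{K}$-bilinear; $V^\times=\{x\in V\mid q(x)\in\mathbb{K}^\times\}$. A group spherical space is a quadratic space with $V^\times\ne\emptyset$ together with a $\mathbb{K}$-trilinear map $V^3\to V$, $(x,y,z)\mapsto\langle xyz\rangle$ satisfying, for all elements: (K) $\langle xxy\rangle=q(x)y=\langle yxx\rangle$; (PA) $\langle ab\langle cde\rangle\rangle=\langle a\langle dcb\rangle e\rangle=\langle\langle abc\rangle de\rangle$; (TC) $q(\langle xyz\rangle)=q(x)q(y)q(z)$. Linear operators on $V$ are defined by $\langle xyz\rangle=L_{x,y}(z)=R_{z,y}(x)=S_{x,z}(y)$. The left (right) spiration algebra $\mathbf{C}_q^L$ (resp. $\mathbf{C}_q^R$) is the $\mathbb{K}$-linear span in $\mathrm{End}(V)$ of all $L_{x,y}$ (resp. all $R_{x,y}$), $x,y\in V$; it is a subalgebra of $\mathrm{End}(V)$. A (generalized) composition algebra over $\mathbb{K}$ is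 a unital $\mathbb{K}$-algebra $(\mathbb{A},1)$ together with a scalar involution, i.e. an anti-automorphism $x\mapsto x^\sharp$ of order $2$ such that $x+x^\sharp\in\mathbb{K}1$ and $xx^\sharp\in\mathbb{K}1$ for all $x\in\mathbb{A}$. Its norm is the quadratic form $N:\mathbb{A}\to\mathbb{K}$ with $xx^\sharp=N(x)1$ (no non-degeneracy is assumed). A quadratic form over a field is anisotropic if $V^\times=V\setminus\{0\}$.
   Formalization: In (0) and (5) the module A, respectively V, is assumed faithful over K (cV = 0 implies c = 0); without this N is not determined by xx^♯ = N(x)1 and (TC) can fail. *)

theory Defs
  imports "HOL-Algebra.Module" "HOL-Algebra.QuotRing"
begin

section \<open>Modules and linear maps\<close>

definition regular_module :: "('k, 'r) ring_scheme \<Rightarrow> ('k, 'k) module" where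
  "regular_module K = \<lparr>carrier = carrier K, mult = mult K, one = one K,
     zero = zero K, add = add K, smult = mult K\<rparr>"

definition linear_map ::
  "('k, 'r) ring_scheme \<Rightarrow> ('k, 'v, 'm) module_scheme \<Rightarrow> ('k, 'w, 'n) module_scheme \<Rightarrow> ('v \<Rightarrow> 'w) \<Rightarrow> bool" where
  "linear_map K V W f \<longleftrightarrow> f \<in> carrier V \<rightarrow> carrier W \<and>
     (\<forall>x\<in>carrier V. \<forall>y\<in>carrier V. f (x \<oplus>\<^bsub>V\<^esub> y) = f x \<oplus>\<^bsub>W\<^esub> f y) \<and>
     (\<forall>c\<in>carrier K. \<forall>x\<in>carrier V. f (c \<odot>\<^bsub>V\<^esub> x) = c \<odot>\<^bsub>W\<^esub> f x)"

text \<open>The ternary composition law is an identity between scalars, whereas the Kirmse laws and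
  para-associativity only give it after letting both sides act on \<open>V\<close>. Without faithfulness it
  can fail: \<open>K = F\<^sub>2[t]/(t\<^sup>2)\<close>, \<open>V = F\<^sub>2[a,b]/(a\<^sup>2,b\<^sup>2)\<close> with \<open>t\<close> acting as zero,
  triple product \<open>xyz\<close>, and \<open>q x = x\<^sub>1 + t x\<^sub>a\<^sub>b\<close> (coefficients of \<open>1\<close> and \<open>ab\<close>); there
  \<open>q (a 1 b) = t\<close> but \<open>q a = q b = 0\<close>. If 2 is not a zero divisor in \<open>K\<close>, or \<open>K\<close> is
  reduced, then \<open>V\<^sup>\<times> \<noteq> {}\<close> already forces \<open>V\<close> to be faithful.\<close>

definition faithful_module :: "('k, 'r) ring_scheme \<Rightarrow> ('k, 'v, 'm) module_scheme \<Rightarrow> bool" where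
  "faithful_module K V \<longleftrightarrow>
     (\<forall>c\<in>carrier K. (\<forall>v\<in>carrier V. c \<odot>\<^bsub>V\<^esub> v = \<zero>\<^bsub>V\<^esub>) \<longrightarrow> c = \<zero>\<^bsub>K\<^esub>)"

definition lin_span :: "('k, 'r) ring_scheme \<Rightarrow> ('k, 'v, 'm) module_scheme \<Rightarrow> 'v set \<Rightarrow> 'v set" where
  "lin_span K V S = \<Inter> {H. submodule H K V \<and> S \<subseteq> H}"

text \<open>Endomorphisms are extensional functions on the carrier, so that equality in the
  endomorphism algebra is pointwise equality on the carrier.\<close>

definition End_alg ::
  "('k, 'r) ring_scheme \<Rightarrow> ('k, 'v, 'm) module_scheme \<Rightarrow> ('k, 'v \<Rightarrow> 'v) module" where
  "End_alg K V = \<lparr>carrier = {f \<in> extensional (carrier V). linear_map K V V f},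
     mult = compose (carrier V), one = (\<lambda>v\<in>carrier V. v),
     zero = (\<lambda>v\<in>carrier V. \<zero>\<^bsub>V\<^esub>), add = (\<lambda>f g. \<lambda>v\<in>carrier V. f v \<oplus>\<^bsub>V\<^esub> g v),
     smult = (\<lambda>c f. \<lambda>v\<in>carrier V. c \<odot>\<^bsub>V\<^esub> f v)\<rparr>"

section \<open>Quadratic spaces\<close>

definition polar :: "('k, 'r) ring_scheme \<Rightarrow> ('k, 'v, 'm) module_scheme \<Rightarrow> ('v \<Rightarrow> 'k) \<Rightarrow> 'v \<Rightarrow> 'v \<Rightarrow> 'k" where
  "polar K V q u v = q (u \<oplus>\<^bsub>V\<^esub> v) \<ominus>\<^bsub>K\<^esub> q u \<ominus>\<^bsub>K\<^esub> q v"

locale quadratic_space = module K V for K (structure) and V (structure) +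
  fixes q
  assumes q_closed: "q \<in> carrier V \<rightarrow> carrier K"
    and q_smult: "c \<in> carrier K \<Longrightarrow> v \<in> carrier V \<Longrightarrow> q (c \<odot>\<^bsub>V\<^esub> v) = c \<otimes>\<^bsub>K\<^esub> c \<otimes>\<^bsub>K\<^esub> q v"
    and polar_linear_left: "v \<in> carrier V \<Longrightarrow> linear_map K V (regular_module K) (\<lambda>u. polar K V q u v)"
    and polar_linear_right: "u \<in> carrier V \<Longrightarrow> linear_map K V (regular_module K) (\<lambda>v. polar K V q u v)"

definition vtimes :: "('k, 'r) ring_scheme \<Rightarrow> ('k, 'v, 'm) module_scheme \<Rightarrow> ('v \<Rightarrow> 'k) \<Rightarrow> 'v set" where
  "vtimes K V q = {x \<in> carrier V. q x \<in> Units K}"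

definition anisotropic :: "('k, 'r) ring_scheme \<Rightarrow> ('k, 'v, 'm) module_scheme \<Rightarrow> ('v \<Rightarrow> 'k) \<Rightarrow> bool" where
  "anisotropic K V q \<longleftrightarrow> vtimes K V q = carrier V - {\<zero>\<^bsub>V\<^esub>}"

section \<open>Group spherical spaces\<close>

locale kirmse_para_space = quadratic_space K V q
  for K (structure) and V (structure) and q +
  fixes T
  assumes vtimes_nonempty: "vtimes K V q \<noteq> {}"
    and T_linear1: "y \<in> carrier V \<Longrightarrow> z \<in> carrier V \<Longrightarrow> linear_map K V V (\<lambda>x. T x y z)"
    and T_linear2: "x \<in> carrier V \<Longrightarrow> z \<in> carrier V \<Longrightarrow> linear_map K V V (\<lambda>y. T x y z)"
    and T_linear3: "x \<in> carrier V \<Longrightarrow> y \<in> carrier V \<Longrightarrow> linear_map K V V (\<lambda>z. T x y z)"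
    and kirmse_left: "x \<in> carrier V \<Longrightarrow> y \<in> carrier V \<Longrightarrow> T x x y = q x \<odot>\<^bsub>V\<^esub> y"
    and kirmse_right: "x \<in> carrier V \<Longrightarrow> y \<in> carrier V \<Longrightarrow> T y x x = q x \<odot>\<^bsub>V\<^esub> y"
    and para_assoc1: "\<lbrakk>a \<in> carrier V; b \<in> carrier V; c \<in> carrier V; d \<in> carrier V; e \<in> carrier V\<rbrakk>
          \<Longrightarrow> T a b (T c d e) = T a (T d c b) e"
    and para_assoc2: "\<lbrakk>a \<in> carrier V; b \<in> carrier V; c \<in> carrier V; d \<in> carrier V; e \<in> carrier V\<rbrakk>
          \<Longrightarrow> T a (T d c b) e = T (T a b c) d e"

definition ternary_composition ::
  "('k, 'r) ring_scheme \<Rightarrow> ('k, 'v, 'm) module_scheme \<Rightarrow> ('v \<Rightarrow> 'k) \<Rightarrow> ('v \<Rightarrow> 'v \<Rightarrow> 'v \<Rightarrow> 'v) \<Rightarrow> bool" where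
  "ternary_composition K V q T \<longleftrightarrow>
     (\<forall>x\<in>carrier V. \<forall>y\<in>carrier V. \<forall>z\<in>carrier V. q (T x y z) = q x \<otimes>\<^bsub>K\<^esub> q y \<otimes>\<^bsub>K\<^esub> q z)"

locale group_spherical_space = kirmse_para_space K V q T
  for K (structure) and V (structure) and q T +
  assumes ternary_comp: "ternary_composition K V q T"

text \<open>The three families of operators are determined by
  \<open>T x y z = Lop V T x y z = Rop V T z y x = Sop V T x z y\<close> on the carrier.\<close>

definition Lop :: "('k, 'v, 'm) module_scheme \<Rightarrow> ('v \<Rightarrow> 'v \<Rightarrow> 'v \<Rightarrow> 'v) \<Rightarrow> 'v \<Rightarrow> 'v \<Rightarrow> 'v \<Rightarrow> 'v" where
  "Lop V T x y = (\<lambda>z\<in>carrier V. T x y z)"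

definition Rop :: "('k, 'v, 'm) module_scheme \<Rightarrow> ('v \<Rightarrow> 'v \<Rightarrow> 'v \<Rightarrow> 'v) \<Rightarrow> 'v \<Rightarrow> 'v \<Rightarrow> 'v \<Rightarrow> 'v" where
  "Rop V T z y = (\<lambda>x\<in>carrier V. T x y z)"

definition Sop :: "('k, 'v, 'm) module_scheme \<Rightarrow> ('v \<Rightarrow> 'v \<Rightarrow> 'v \<Rightarrow> 'v) \<Rightarrow> 'v \<Rightarrow> 'v \<Rightarrow> 'v \<Rightarrow> 'v" where
  "Sop V T x z = (\<lambda>y\<in>carrier V. T x y z)"

definition spiration_L ::
  "('k, 'r) ring_scheme \<Rightarrow> ('k, 'v, 'm) module_scheme \<Rightarrow> ('v \<Rightarrow> 'v \<Rightarrow> 'v \<Rightarrow> 'v) \<Rightarrow> ('k, 'v \<Rightarrow> 'v) module" where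
  "spiration_L K V T = (End_alg K V)\<lparr>carrier :=
     lin_span K (End_alg K V) {Lop V T x y | x y. x \<in> carrier V \<and> y \<in> carrier V}\<rparr>"

definition spiration_R ::
  "('k, 'r) ring_scheme \<Rightarrow> ('k, 'v, 'm) module_scheme \<Rightarrow> ('v \<Rightarrow> 'v \<Rightarrow> 'v \<Rightarrow> 'v) \<Rightarrow> ('k, 'v \<Rightarrow> 'v) module" where
  "spiration_R K V T = (End_alg K V)\<lparr>carrier :=
     lin_span K (End_alg K V) {Rop V T x y | x y. x \<in> carrier V \<and> y \<in> carrier V}\<rparr>"

section \<open>Algebras\<close>

text \<open>Unital algebras are not assumed associative; an associative one is in addition a
  \<^term>\<open>ring\<close>. The locale \<^term>\<open>algebra\<close> of HOL-Algebra does not fit because it demands a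
  commutative multiplication.\<close>

locale unital_algebra = module K A for K (structure) and A (structure) +
  assumes one_mem: "\<one>\<^bsub>A\<^esub> \<in> carrier A"
    and one_left: "x \<in> carrier A \<Longrightarrow> \<one>\<^bsub>A\<^esub> \<otimes>\<^bsub>A\<^esub> x = x"
    and one_right: "x \<in> carrier A \<Longrightarrow> x \<otimes>\<^bsub>A\<^esub> \<one>\<^bsub>A\<^esub> = x"
    and mult_linear_left: "y \<in> carrier A \<Longrightarrow> linear_map K A A (\<lambda>x. x \<otimes>\<^bsub>A\<^esub> y)"
    and mult_linear_right: "x \<in> carrier A \<Longrightarrow> linear_map K A A (\<lambda>y. x \<otimes>\<^bsub>A\<^esub> y)"

text \<open>``Order 2'' means that the square of the involution is the identity; the identity map
  itself is allowed (as for the algebra \<open>K\<close> over \<open>K\<close>).\<close>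

locale composition_algebra = unital_algebra K A for K (structure) and A (structure) +
  fixes sharp
  assumes sharp_linear: "linear_map K A A sharp"
    and sharp_mult: "x \<in> carrier A \<Longrightarrow> y \<in> carrier A \<Longrightarrow> sharp (x \<otimes>\<^bsub>A\<^esub> y) = sharp y \<otimes>\<^bsub>A\<^esub> sharp x"
    and sharp_sharp: "x \<in> carrier A \<Longrightarrow> sharp (sharp x) = x"
    and trace_scalar: "x \<in> carrier A \<Longrightarrow> \<exists>c\<in>carrier K. x \<oplus>\<^bsub>A\<^esub> sharp x = c \<odot>\<^bsub>A\<^esub> \<one>\<^bsub>A\<^esub>"
    and norm_scalar: "x \<in> carrier A \<Longrightarrow> \<exists>c\<in>carrier K. x \<otimes>\<^bsub>A\<^esub> sharp x = c \<odot>\<^bsub>A\<^esub> \<one>\<^bsub>A\<^esub>"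

text \<open>If \<open>A\<close> is a faithful \<open>K\<close>-module, this equation determines \<open>N\<close> uniquely and makes it
  a quadratic form. In general it only determines \<open>N\<close> up to scalars annihilating \<open>A\<close>.\<close>

definition is_norm ::
  "('k, 'r) ring_scheme \<Rightarrow> ('k, 'a, 'm) module_scheme \<Rightarrow> ('a \<Rightarrow> 'a) \<Rightarrow> ('a \<Rightarrow> 'k) \<Rightarrow> bool" where
  "is_norm K A sharp N \<longleftrightarrow> N \<in> carrier A \<rightarrow> carrier K \<and>
     (\<forall>x\<in>carrier A. x \<otimes>\<^bsub>A\<^esub> sharp x = N x \<odot>\<^bsub>A\<^esub> \<one>\<^bsub>A\<^esub>)"

definition opposite_alg :: "('k, 'a, 'm) module_scheme \<Rightarrow> ('k, 'a, 'm) module_scheme" where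
  "opposite_alg A = A\<lparr>mult := (\<lambda>x y. y \<otimes>\<^bsub>A\<^esub> x)\<rparr>"

definition algebra_iso ::
  "('k, 'r) ring_scheme \<Rightarrow> ('k, 'a, 'm) module_scheme \<Rightarrow> ('k, 'b, 'n) module_scheme \<Rightarrow> ('a \<Rightarrow> 'b) set" where
  "algebra_iso K A B = {h \<in> ring_iso A B.
     \<forall>c\<in>carrier K. \<forall>x\<in>carrier A. h (c \<odot>\<^bsub>A\<^esub> x) = c \<odot>\<^bsub>B\<^esub> h x}"

definition skew_field :: "('a, 'm) ring_scheme \<Rightarrow> bool" where
  "skew_field R \<longleftrightarrow> ring R \<and> \<one>\<^bsub>R\<^esub> \<noteq> \<zero>\<^bsub>R\<^esub> \<and> Units R = carrier R - {\<zero>\<^bsub>R\<^esub>}"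

section \<open>The two constructions\<close>

definition alg_triple ::
  "('k, 'a, 'm) module_scheme \<Rightarrow> ('a \<Rightarrow> 'a) \<Rightarrow> 'k \<Rightarrow> 'a \<Rightarrow> 'a \<Rightarrow> 'a \<Rightarrow> 'a" where
  "alg_triple A sharp l x y z = l \<odot>\<^bsub>A\<^esub> (x \<otimes>\<^bsub>A\<^esub> sharp y \<otimes>\<^bsub>A\<^esub> z)"

definition alg_form :: "('k, 'r) ring_scheme \<Rightarrow> ('a \<Rightarrow> 'k) \<Rightarrow> 'k \<Rightarrow> 'a \<Rightarrow> 'k" where
  "alg_form K N l x = l \<otimes>\<^bsub>K\<^esub> N x"

text \<open>The multiplication and unit that the record \<open>V\<close> may already carry are overwritten.\<close>

definition base_alg ::
  "('k, 'r) ring_scheme \<Rightarrow> ('k, 'v, 'm) module_scheme \<Rightarrow> ('v \<Rightarrow> 'k) \<Rightarrow> ('v \<Rightarrow> 'v \<Rightarrow> 'v \<Rightarrow> 'v) \<Rightarrow> 'v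
    \<Rightarrow> ('k, 'v, 'm) module_scheme" where
  "base_alg K V q T e = V\<lparr>mult := (\<lambda>x z. inv\<^bsub>K\<^esub> (q e) \<odot>\<^bsub>V\<^esub> T x e z), one := e\<rparr>"

definition base_sharp ::
  "('k, 'r) ring_scheme \<Rightarrow> ('k, 'v, 'm) module_scheme \<Rightarrow> ('v \<Rightarrow> 'k) \<Rightarrow> ('v \<Rightarrow> 'v \<Rightarrow> 'v \<Rightarrow> 'v) \<Rightarrow> 'v
    \<Rightarrow> 'v \<Rightarrow> 'v" where
  "base_sharp K V q T e = inv\<^bsub>K\<^esub> (q e) \<odot>\<^bsub>End_alg K V\<^esub> Sop V T e e"

definition base_norm :: "('k, 'r) ring_scheme \<Rightarrow> ('v \<Rightarrow> 'k) \<Rightarrow> 'v \<Rightarrow> 'v \<Rightarrow> 'k" where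
  "base_norm K q e x = q x \<otimes>\<^bsub>K\<^esub> inv\<^bsub>K\<^esub> (q e)"

definition left_rep ::
  "('k, 'r) ring_scheme \<Rightarrow> ('k, 'v, 'm) module_scheme \<Rightarrow> ('v \<Rightarrow> 'k) \<Rightarrow> ('v \<Rightarrow> 'v \<Rightarrow> 'v \<Rightarrow> 'v) \<Rightarrow> 'v
    \<Rightarrow> 'v \<Rightarrow> 'v \<Rightarrow> 'v" where
  "left_rep K V q T e v = inv\<^bsub>K\<^esub> (q e) \<odot>\<^bsub>End_alg K V\<^esub> Lop V T v e"

definition right_rep ::
  "('k, 'r) ring_scheme \<Rightarrow> ('k, 'v, 'm) module_scheme \<Rightarrow> ('v \<Rightarrow> 'k) \<Rightarrow> ('v \<Rightarrow> 'v \<Rightarrow> 'v \<Rightarrow> 'v) \<Rightarrow> 'v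
    \<Rightarrow> 'v \<Rightarrow> 'v \<Rightarrow> 'v" where
  "right_rep K V q T e v = inv\<^bsub>K\<^esub> (q e) \<odot>\<^bsub>End_alg K V\<^esub> Rop V T v e"

end

theory Submission
  imports Defs
begin

text \<open>Polarizing the first Kirmse law at \<open>x, e\<close> shows that \<open>\<langle>exe\<rangle>\<close> is the reflection
  \<open>b\<^sub>q(x,e) e - q(e) x\<close>. This makes \<open>s\<^sub>e\<close> a scalar involution of the algebra \<open>V\<close> with product
  \<open>\<langle>xez\<rangle> / q(e)\<close>, and para-associativity with \<open>e\<close> inserted gives associativity and
  \<open>\<langle>xyz\<rangle> = q(e) x \<cdot> s\<^sub>e y \<cdot> z\<close>. Hence \<open>L\<^bsub>x,y\<^esub>\<close> is left translation by \<open>q(e) x \<cdot> s\<^sub>e y\<close>, so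
  the translations already exhaust the span of the \<open>L\<^bsub>x,y\<^esub>\<close>; likewise on the right. By the
  composition law, the units of this algebra are exactly the vectors on which \<open>q\<close> is
  invertible.\<close>

section \<open>Linear maps and spans\<close>

lemma linear_mapD:
  assumes "linear_map K V W f"
  shows "x \<in> carrier V \<Longrightarrow> f x \<in> carrier W"
    and "x \<in> carrier V \<Longrightarrow> y \<in> carrier V \<Longrightarrow> f (x \<oplus>\<^bsub>V\<^esub> y) = f x \<oplus>\<^bsub>W\<^esub> f y"
    and "c \<in> carrier K \<Longrightarrow> x \<in> carrier V \<Longrightarrow> f (c \<odot>\<^bsub>V\<^esub> x) = c \<odot>\<^bsub>W\<^esub> f x"
  using assms by (auto simp: linear_map_def)

lemma linear_mapI:
  assumes "\<And>x. x \<in> carrier V \<Longrightarrow> f x \<in> carrier W"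
    and "\<And>x y. x \<in> carrier V \<Longrightarrow> y \<in> carrier V \<Longrightarrow> f (x \<oplus>\<^bsub>V\<^esub> y) = f x \<oplus>\<^bsub>W\<^esub> f y"
    and "\<And>c x. c \<in> carrier K \<Longrightarrow> x \<in> carrier V \<Longrightarrow> f (c \<odot>\<^bsub>V\<^esub> x) = c \<odot>\<^bsub>W\<^esub> f x"
  shows "linear_map K V W f"
  using assms by (auto simp: linear_map_def)

lemma regular_module_simps [simp]:
  "carrier (regular_module K) = carrier K"
  "add (regular_module K) = add K"
  "smult (regular_module K) = mult K"
  by (simp_all add: regular_module_def)

text \<open>Zero and negatives are the scalar multiples by 0 and -1, so additivity and homogeneity
  suffice. Below, this makes the image of \<open>\<L>\<close> and that of \<open>\<R>\<close>
  submodules of the endomorphisms.\<close>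

lemma linear_map_image_submodule:
  assumes V: "module K V" and W: "module K W" and f: "linear_map K V W f"
  shows "submodule (f ` carrier V) K W"
proof -
  interpret V: module K V by (rule V)
  interpret W: module K W by (rule W)
  note fD = linear_mapD[OF f]
  have zero: "f \<zero>\<^bsub>V\<^esub> = \<zero>\<^bsub>W\<^esub>"
    using fD(3)[of "\<zero>\<^bsub>K\<^esub>" "\<zero>\<^bsub>V\<^esub>"] fD(1) by simp
  have neg: "\<ominus>\<^bsub>W\<^esub> f x = f (\<ominus>\<^bsub>V\<^esub> x)" if "x \<in> carrier V" for x
    using that fD(3)[of "\<ominus>\<^bsub>K\<^esub> \<one>\<^bsub>K\<^esub>" x] fD(1)[OF that]
    by (simp add: V.smult_l_minus W.smult_l_minus)
  show ?thesis
  proof (rule W.submoduleI)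
    show "f ` carrier V \<subseteq> carrier W"
      using fD(1) by blast
    show "\<zero>\<^bsub>W\<^esub> \<in> f ` carrier V"
      using zero V.M.zero_closed by (metis imageI)
    show "\<ominus>\<^bsub>W\<^esub> a \<in> f ` carrier V" if "a \<in> f ` carrier V" for a
      using that neg by auto
    show "a \<oplus>\<^bsub>W\<^esub> b \<in> f ` carrier V" if "a \<in> f ` carrier V" "b \<in> f ` carrier V" for a b
      using that by (auto simp flip: fD(2))
    show "c \<odot>\<^bsub>W\<^esub> a \<in> f ` carrier V" if "c \<in> carrier K" "a \<in> f ` carrier V" for c a
      using that by (auto simp flip: fD(3))
  qed
qed

lemma lin_span_eqI:
  assumes "submodule H K V" "S \<subseteq> H"
    and "\<And>G. submodule G K V \<Longrightarrow> S \<subseteq> G \<Longrightarrow> H \<subseteq> G"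
  shows "lin_span K V S = H"
  using assms unfolding lin_span_def by blast

lemma End_alg_simps [simp]:
  "carrier (End_alg K V) = {f \<in> extensional (carrier V). linear_map K V V f}"
  "mult (End_alg K V) = compose (carrier V)"
  "one (End_alg K V) = (\<lambda>v\<in>carrier V. v)"
  "zero (End_alg K V) = (\<lambda>v\<in>carrier V. \<zero>\<^bsub>V\<^esub>)"
  "add (End_alg K V) = (\<lambda>f g. \<lambda>v\<in>carrier V. f v \<oplus>\<^bsub>V\<^esub> g v)"
  "smult (End_alg K V) = (\<lambda>c f. \<lambda>v\<in>carrier V. c \<odot>\<^bsub>V\<^esub> f v)"
  by (simp_all add: End_alg_def)

lemma spiration_L_simps [simp]:
  "mult (spiration_L K V T) = mult (End_alg K V)"
  "one (spiration_L K V T) = one (End_alg K V)"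
  "add (spiration_L K V T) = add (End_alg K V)"
  "smult (spiration_L K V T) = smult (End_alg K V)"
  by (simp_all add: spiration_L_def)

lemma spiration_R_simps [simp]:
  "mult (spiration_R K V T) = mult (End_alg K V)"
  "one (spiration_R K V T) = one (End_alg K V)"
  "add (spiration_R K V T) = add (End_alg K V)"
  "smult (spiration_R K V T) = smult (End_alg K V)"
  by (simp_all add: spiration_R_def)

lemma opposite_alg_simps [simp]:
  "carrier (opposite_alg A) = carrier A"
  "mult (opposite_alg A) x y = y \<otimes>\<^bsub>A\<^esub> x"
  "one (opposite_alg A) = one A"
  "add (opposite_alg A) = add A"
  "smult (opposite_alg A) = smult A"
  by (simp_all add: opposite_alg_def)

section \<open>Scalar identities and the module of endomorphisms\<close>

context module
begin

text \<open>The difference \<open>c \<ominus> d\<close> annihilates \<open>M\<close>. This is the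
  bridge from identities between vectors to identities between scalars.\<close>

lemma faithful_eqI:
  assumes faithful: "faithful_module R M" and c: "c \<in> carrier R" and d: "d \<in> carrier R"
    and eq: "\<And>v. v \<in> carrier M \<Longrightarrow> c \<odot>\<^bsub>M\<^esub> v = d \<odot>\<^bsub>M\<^esub> v"
  shows "c = d"
proof -
  have "(c \<ominus> d) \<odot>\<^bsub>M\<^esub> v = \<zero>\<^bsub>M\<^esub>" if "v \<in> carrier M" for v
    using that c d by (simp add: R.minus_eq smult_l_distr smult_l_minus eq M.r_neg)
  then have "c \<ominus> d = \<zero>"
    using faithful c d R.minus_closed unfolding faithful_module_def by blast
  then show ?thesis
    using c d R.minus_equality[of c "\<ominus> d"] by (simp add: R.minus_eq)
qed

text \<open>As a permutative simp rule it sorts nested scalars. It carries the commutativity of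
  \<open>R\<close>, by which a scalar multiple of a linear map is again linear.\<close>

lemma smult_commute:
  assumes "a \<in> carrier R" "b \<in> carrier R" "x \<in> carrier M"
  shows "a \<odot>\<^bsub>M\<^esub> (b \<odot>\<^bsub>M\<^esub> x) = b \<odot>\<^bsub>M\<^esub> (a \<odot>\<^bsub>M\<^esub> x)"
  using assms by (simp add: m_comm flip: smult_assoc1)

lemma module_End_alg: "module R (End_alg R M)"
proof (rule moduleI)
  show "abelian_group (End_alg R M)"
  proof (rule abelian_groupI)
    fix f assume f: "f \<in> carrier (End_alg R M)"
    \<comment> \<open>Scaling by -1 instead of negating pointwise lets the linearity of the additive
      inverse come from \<open>smult_commute\<close>.\<close>
    have "(\<lambda>v\<in>carrier M. \<ominus> \<one> \<odot>\<^bsub>M\<^esub> f v) \<in> carrier (End_alg R M)"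
      using f by (simp add: linear_map_def Pi_iff smult_r_distr smult_commute)
    moreover have "(\<lambda>v\<in>carrier M. \<ominus> \<one> \<odot>\<^bsub>M\<^esub> f v) \<oplus>\<^bsub>End_alg R M\<^esub> f = \<zero>\<^bsub>End_alg R M\<^esub>"
      using f by (auto intro!: ext simp: smult_l_minus M.l_neg linear_map_def Pi_iff)
    ultimately show "\<exists>g\<in>carrier (End_alg R M). g \<oplus>\<^bsub>End_alg R M\<^esub> f = \<zero>\<^bsub>End_alg R M\<^esub>"
      by blast
  qed (auto intro!: extensionalityI[of _ "carrier M"]
        simp: linear_map_def Pi_iff smult_r_distr M.a_ac)
qed (auto intro!: extensionalityI[of _ "carrier M"] R.is_cring
      simp: linear_map_def Pi_iff smult_l_distr smult_r_distr smult_assoc1 smult_commute)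

end

section \<open>Para-associative Kirmse spaces\<close>

context quadratic_space
begin

lemma q_mem [simp]: "x \<in> carrier V \<Longrightarrow> q x \<in> carrier K"
  using q_closed by blast

lemma polar_closed [simp]: "x \<in> carrier V \<Longrightarrow> y \<in> carrier V \<Longrightarrow> polar K V q x y \<in> carrier K"
  using linear_mapD(1)[OF polar_linear_left] by simp

lemma q_add:
  assumes "x \<in> carrier V" "y \<in> carrier V"
  shows "q (x \<oplus>\<^bsub>V\<^esub> y) = polar K V q x y \<oplus> q x \<oplus> q y"
proof -
  have "polar K V q x y \<oplus> q x \<oplus> q y = q (x \<oplus>\<^bsub>V\<^esub> y) \<oplus> (\<ominus> q x \<oplus> q x) \<oplus> (\<ominus> q y \<oplus> q y)"
    unfolding polar_def a_minus_def using assms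
    by (simp only: q_mem M.a_closed R.a_closed R.a_inv_closed R.a_ac)
  then show ?thesis
    using assms by (simp add: R.l_neg)
qed

end

context kirmse_para_space
begin

lemma T_closed [simp]:
  "x \<in> carrier V \<Longrightarrow> y \<in> carrier V \<Longrightarrow> z \<in> carrier V \<Longrightarrow> T x y z \<in> carrier V"
  using linear_mapD(1)[OF T_linear1] by simp

lemma T_add:
  assumes "x \<in> carrier V" "x' \<in> carrier V" "y \<in> carrier V" "z \<in> carrier V"
  shows "T (x \<oplus>\<^bsub>V\<^esub> x') y z = T x y z \<oplus>\<^bsub>V\<^esub> T x' y z"
    and "T y (x \<oplus>\<^bsub>V\<^esub> x') z = T y x z \<oplus>\<^bsub>V\<^esub> T y x' z"
    and "T y z (x \<oplus>\<^bsub>V\<^esub> x') = T y z x \<oplus>\<^bsub>V\<^esub> T y z x'"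
  using assms linear_mapD(2)[OF T_linear1] linear_mapD(2)[OF T_linear2]
    linear_mapD(2)[OF T_linear3] by simp_all

lemma T_smult:
  assumes "c \<in> carrier K" "x \<in> carrier V" "y \<in> carrier V" "z \<in> carrier V"
  shows "T (c \<odot>\<^bsub>V\<^esub> x) y z = c \<odot>\<^bsub>V\<^esub> T x y z"
    and "T y (c \<odot>\<^bsub>V\<^esub> x) z = c \<odot>\<^bsub>V\<^esub> T y x z"
    and "T y z (c \<odot>\<^bsub>V\<^esub> x) = c \<odot>\<^bsub>V\<^esub> T y z x"
  using assms linear_mapD(3)[OF T_linear1] linear_mapD(3)[OF T_linear2]
    linear_mapD(3)[OF T_linear3] by simp_all

text \<open>Oriented for simp: an inner triple product in the first or middle slot moves to the last
  one, with the right-nested form as normal form.\<close>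

lemma para_assoc:
  assumes "a \<in> carrier V" "b \<in> carrier V" "c \<in> carrier V" "d \<in> carrier V" "e \<in> carrier V"
  shows "T (T a b c) d e = T a b (T c d e)" and "T a (T d c b) e = T a b (T c d e)"
  using assms para_assoc1 para_assoc2 by simp_all

text \<open>Polarizing \<open>T x x z = q x \<odot> z\<close> at \<open>x, e\<close> and putting \<open>z = e\<close>.\<close>

lemma T_flip:
  assumes x: "x \<in> carrier V" and e: "e \<in> carrier V"
  shows "T e x e = polar K V q x e \<odot>\<^bsub>V\<^esub> e \<ominus>\<^bsub>V\<^esub> q e \<odot>\<^bsub>V\<^esub> x"
proof -
  \<comment> \<open>The sum of the diagonal terms \<open>T x x e\<close> and \<open>T e e e\<close>;
    it occurs on both sides of the polarized law and is cancelled.\<close>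
  let ?c = "q x \<odot>\<^bsub>V\<^esub> e \<oplus>\<^bsub>V\<^esub> q e \<odot>\<^bsub>V\<^esub> e"
  have "?c \<oplus>\<^bsub>V\<^esub> (T e x e \<oplus>\<^bsub>V\<^esub> q e \<odot>\<^bsub>V\<^esub> x)
      = (T x x e \<oplus>\<^bsub>V\<^esub> T e x e) \<oplus>\<^bsub>V\<^esub> (T x e e \<oplus>\<^bsub>V\<^esub> T e e e)"
    using assms by (simp add: kirmse_left kirmse_right M.a_ac)
  also have "\<dots> = T (x \<oplus>\<^bsub>V\<^esub> e) (x \<oplus>\<^bsub>V\<^esub> e) e"
    using assms by (simp only: T_add M.a_closed)
  also have "\<dots> = q (x \<oplus>\<^bsub>V\<^esub> e) \<odot>\<^bsub>V\<^esub> e"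
    using assms by (simp add: kirmse_left)
  also have "\<dots> = ?c \<oplus>\<^bsub>V\<^esub> polar K V q x e \<odot>\<^bsub>V\<^esub> e"
    using assms by (subst q_add) (simp_all add: smult_l_distr M.a_ac)
  finally have "?c \<oplus>\<^bsub>V\<^esub> (T e x e \<oplus>\<^bsub>V\<^esub> q e \<odot>\<^bsub>V\<^esub> x) = ?c \<oplus>\<^bsub>V\<^esub> polar K V q x e \<odot>\<^bsub>V\<^esub> e" .
  then have "T e x e \<oplus>\<^bsub>V\<^esub> q e \<odot>\<^bsub>V\<^esub> x = polar K V q x e \<odot>\<^bsub>V\<^esub> e"
    using assms by simp
  then show ?thesis
    using assms by (simp add: M.minus_eq M.add.inv_solve_right)
qed

text \<open>Both sides act in the same way on \<open>V\<close>, by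
  \<open>\<langle>\<langle>xyz\<rangle>\<langle>xyz\<rangle>v\<rangle> = \<langle>xy\<langle>zz\<langle>yxv\<rangle>\<rangle>\<rangle>\<close>.\<close>

lemma ternary_composition:
  assumes faithful: "faithful_module K V"
  shows "ternary_composition K V q T"
  unfolding ternary_composition_def
proof (intro ballI)
  fix x y z assume xyz: "x \<in> carrier V" "y \<in> carrier V" "z \<in> carrier V"
  have act: "q (T x y z) \<odot>\<^bsub>V\<^esub> v = (q x \<otimes> q y \<otimes> q z) \<odot>\<^bsub>V\<^esub> v" if v: "v \<in> carrier V" for v
  proof -
    have "q (T x y z) \<odot>\<^bsub>V\<^esub> v = T (T x y z) (T x y z) v"
      using xyz v by (simp add: kirmse_left)
    also have "\<dots> = T x y (T z z (T y x v))"
      using xyz v by (simp add: para_assoc)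
    \<comment> \<open>Once \<open>z\<close> is absorbed, the product is bracketed to the left again,
      so that the two occurrences of \<open>y\<close> become neighbours.\<close>
    also have "\<dots> = q z \<odot>\<^bsub>V\<^esub> T (T x y y) x v"
      using xyz v by (simp add: kirmse_left T_smult para_assoc)
    also have "\<dots> = q z \<odot>\<^bsub>V\<^esub> (q y \<odot>\<^bsub>V\<^esub> (q x \<odot>\<^bsub>V\<^esub> v))"
      using xyz v by (simp add: kirmse_left kirmse_right T_smult)
    also have "\<dots> = (q x \<otimes> q y \<otimes> q z) \<odot>\<^bsub>V\<^esub> v"
      using xyz v by (simp add: R.m_ac flip: smult_assoc1)
    finally show ?thesis .
  qed
  then show "q (T x y z) = q x \<otimes> q y \<otimes> q z"
    using xyz by (intro faithful_eqI[OF faithful]) simp_all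
qed

end

section \<open>The algebra of a pointed space\<close>

locale pointed_kirmse_space = kirmse_para_space K V q T
  for K (structure) and V (structure) and q T +
  fixes e
  assumes base: "e \<in> vtimes K V q"
begin

abbreviation "i \<equiv> inv q e"
abbreviation "B \<equiv> base_alg K V q T e"
abbreviation "s \<equiv> base_sharp K V q T e"

lemma base_closed [simp]: "e \<in> carrier V"
  using base by (simp add: vtimes_def)

lemma q_base_Unit [simp]: "q e \<in> Units K"
  using base by (simp add: vtimes_def)

lemma i_closed [simp]: "i \<in> carrier K"
  by simp

lemma scalar_cancel [simp]:
  assumes "x \<in> carrier V"
  shows "i \<odot>\<^bsub>V\<^esub> (q e \<odot>\<^bsub>V\<^esub> x) = x" and "q e \<odot>\<^bsub>V\<^esub> (i \<odot>\<^bsub>V\<^esub> x) = x"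
  using assms by (simp_all flip: smult_assoc1)

lemma base_alg_simps [simp]:
  "carrier B = carrier V" "add B = add V" "zero B = zero V" "smult B = smult V"
  "one B = e" "mult B x z = i \<odot>\<^bsub>V\<^esub> T x e z"
  by (simp_all add: base_alg_def)

lemma base_sharp_eq [simp]: "x \<in> carrier V \<Longrightarrow> s x = i \<odot>\<^bsub>V\<^esub> T e x e"
  by (simp add: base_sharp_def Sop_def)

text \<open>This is \<open>T_flip\<close> divided by \<open>q e\<close>: the map \<open>s\<close> is
  minus the orthogonal reflection along \<open>e\<close>.\<close>

lemma base_sharp_eq_reflection:
  assumes "x \<in> carrier V"
  shows "s x = (polar K V q x e \<otimes> i) \<odot>\<^bsub>V\<^esub> e \<ominus>\<^bsub>V\<^esub> x"
  using assms
  by (simp add: T_flip M.minus_eq smult_r_distr smult_r_minus smult_assoc1 smult_commute)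

text \<open>Each inserted pair of \<open>e\<close> is absorbed by a Kirmse law at the price
  \<open>q e\<close>: first \<open>T x e (T e y e) = T (T x e e) y e\<close>, then
  \<open>T (T x y e) e z = T x y (T e e z)\<close>.\<close>

lemma base_triple:
  assumes "x \<in> carrier V" "y \<in> carrier V" "z \<in> carrier V"
  shows "T x y z = q e \<odot>\<^bsub>V\<^esub> (x \<otimes>\<^bsub>B\<^esub> s y \<otimes>\<^bsub>B\<^esub> z)"
proof -
  have "x \<otimes>\<^bsub>B\<^esub> s y = i \<odot>\<^bsub>V\<^esub> (i \<odot>\<^bsub>V\<^esub> T (T x e e) y e)"
    using assms by (simp add: T_smult para_assoc)
  also have "\<dots> = i \<odot>\<^bsub>V\<^esub> T x y e"
    using assms by (simp add: T_smult kirmse_right)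
  finally have "x \<otimes>\<^bsub>B\<^esub> s y \<otimes>\<^bsub>B\<^esub> z = i \<odot>\<^bsub>V\<^esub> (i \<odot>\<^bsub>V\<^esub> T x y (T e e z))"
    using assms by (simp add: T_smult para_assoc)
  also have "\<dots> = i \<odot>\<^bsub>V\<^esub> T x y z"
    using assms by (simp add: T_smult kirmse_left)
  finally show ?thesis
    using assms by simp
qed

section \<open>Algebra axioms, involution and norm at the base point\<close>

lemma module_base_alg: "module K B"
proof (rule moduleI)
  show "abelian_group B"
    by (rule abelian_groupI) (auto simp: M.a_ac intro: M.l_neg)
qed (simp_all add: R.is_cring smult_l_distr smult_r_distr smult_assoc1)

lemma mult_base_linear:
  assumes "y \<in> carrier V"
  shows "linear_map K B B (\<lambda>x. x \<otimes>\<^bsub>B\<^esub> y)" and "linear_map K B B (\<lambda>x. y \<otimes>\<^bsub>B\<^esub> x)"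
  using assms
  by (auto intro!: linear_mapI simp: T_add T_smult smult_r_distr smult_commute)

lemma unital_algebra_base_alg: "unital_algebra K B"
proof (intro unital_algebra.intro module_base_alg unital_algebra_axioms.intro)
  show "linear_map K B B (\<lambda>x. x \<otimes>\<^bsub>B\<^esub> y)" if "y \<in> carrier B" for y
    using that by (intro mult_base_linear) simp
  show "linear_map K B B (\<lambda>y. x \<otimes>\<^bsub>B\<^esub> y)" if "x \<in> carrier B" for x
    using that by (intro mult_base_linear) simp
qed (simp_all add: kirmse_left kirmse_right)

text \<open>Associativity is para-associativity with \<open>e\<close> in the second and fourth
  slots; the unit laws are the Kirmse laws at \<open>e\<close>.\<close>

lemma ring_base_alg: "ring B"
proof (rule ringI)
  show "abelian_group B"
    using module_base_alg by (simp add: module_def)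
  show "monoid B"
    by (rule monoidI) (simp_all add: T_smult para_assoc kirmse_left kirmse_right)
qed (simp_all add: T_add smult_r_distr)

text \<open>Rebracketing brings two \<open>e\<close> together, which leaves \<open>T x x e\<close>
  and \<open>T e x x\<close>, respectively. Both orders serve later to obtain two-sided
  inverses.\<close>

lemma mult_base_sharp:
  assumes "x \<in> carrier V"
  shows "x \<otimes>\<^bsub>B\<^esub> s x = base_norm K q e x \<odot>\<^bsub>V\<^esub> e"
    and "s x \<otimes>\<^bsub>B\<^esub> x = base_norm K q e x \<odot>\<^bsub>V\<^esub> e"
proof -
  have "x \<otimes>\<^bsub>B\<^esub> s x = i \<odot>\<^bsub>V\<^esub> (i \<odot>\<^bsub>V\<^esub> T (T x e e) x e)"
    using assms by (simp add: T_smult para_assoc)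
  also have "\<dots> = i \<odot>\<^bsub>V\<^esub> (q x \<odot>\<^bsub>V\<^esub> e)"
    using assms by (simp add: T_smult kirmse_left kirmse_right)
  finally show "x \<otimes>\<^bsub>B\<^esub> s x = base_norm K q e x \<odot>\<^bsub>V\<^esub> e"
    using assms by (simp add: base_norm_def smult_assoc1 smult_commute)
  have "s x \<otimes>\<^bsub>B\<^esub> x = i \<odot>\<^bsub>V\<^esub> (q x \<odot>\<^bsub>V\<^esub> e)"
    using assms by (simp add: T_smult para_assoc kirmse_left kirmse_right)
  then show "s x \<otimes>\<^bsub>B\<^esub> x = base_norm K q e x \<odot>\<^bsub>V\<^esub> e"
    using assms by (simp add: base_norm_def smult_assoc1 smult_commute)
qed

lemma base_norm_closed: "x \<in> carrier V \<Longrightarrow> base_norm K q e x \<in> carrier K"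
  by (simp add: base_norm_def)

lemma is_norm_base_norm: "is_norm K B s (base_norm K q e)"
  unfolding is_norm_def
  using mult_base_sharp by (simp add: base_norm_closed del: base_sharp_eq base_alg_simps(6))

text \<open>The middle-slot form of para-associativity reverses the factors:
  \<open>T e (T x e y) e = T e y (T e x e)\<close>. The other side differs only by a pair of
  \<open>e\<close> and a factor \<open>i\<close>.\<close>

lemma sharp_base_antimult:
  assumes "x \<in> carrier V" "y \<in> carrier V"
  shows "s (x \<otimes>\<^bsub>B\<^esub> y) = s y \<otimes>\<^bsub>B\<^esub> s x"
  using assms by (simp add: T_smult para_assoc kirmse_left)

text \<open>Para-associativity gives \<open>T e (T e x e) e = T e e (T x e e)\<close>, and both
  Kirmse laws apply.\<close>

lemma sharp_base_involutive:
  assumes "x \<in> carrier V"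
  shows "s (s x) = x"
  using assms by (simp add: T_smult para_assoc kirmse_left kirmse_right)

lemma trace_base:
  assumes "x \<in> carrier V"
  shows "x \<oplus>\<^bsub>V\<^esub> s x = (polar K V q x e \<otimes> i) \<odot>\<^bsub>V\<^esub> e"
  using assms
  by (simp add: base_sharp_eq_reflection M.minus_eq M.a_lcomm[of x] M.r_neg del: base_sharp_eq)

lemma composition_algebra_base_alg: "composition_algebra K B s"
proof (intro composition_algebra.intro unital_algebra_base_alg composition_algebra_axioms.intro)
  show "linear_map K B B s"
    by (auto intro!: linear_mapI simp: T_add T_smult smult_r_distr smult_commute)
  show "\<exists>c\<in>carrier K. x \<oplus>\<^bsub>B\<^esub> s x = c \<odot>\<^bsub>B\<^esub> \<one>\<^bsub>B\<^esub>" if "x \<in> carrier B" for x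
    using that trace_base[of x] by (auto simp del: base_sharp_eq intro!: bexI)
  show "\<exists>c\<in>carrier K. x \<otimes>\<^bsub>B\<^esub> s x = c \<odot>\<^bsub>B\<^esub> \<one>\<^bsub>B\<^esub>" if "x \<in> carrier B" for x
    using that mult_base_sharp[of x] base_norm_closed[of x] by auto
qed (use sharp_base_antimult sharp_base_involutive in auto)

text \<open>Scaling \<open>q\<close> by the constant \<open>i\<close> scales the polar form by
  \<open>i\<close>, so bilinearity is inherited.\<close>

lemma quadratic_space_base_norm: "quadratic_space K B (base_norm K q e)"
proof (intro quadratic_space.intro module_base_alg quadratic_space_axioms.intro)
  have polar: "polar K B (base_norm K q e) u v = polar K V q u v \<otimes> i"
    if "u \<in> carrier V" "v \<in> carrier V" for u v
    using that by (simp add: polar_def base_norm_def R.minus_eq R.l_distr R.l_minus)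
  show "linear_map K B (regular_module K) (\<lambda>u. polar K B (base_norm K q e) u v)"
    if "v \<in> carrier B" for v
    using that linear_mapD[OF polar_linear_left[of v]]
    by (auto intro!: linear_mapI simp: polar R.l_distr R.m_assoc)
  show "linear_map K B (regular_module K) (\<lambda>v. polar K B (base_norm K q e) u v)"
    if "u \<in> carrier B" for u
    using that linear_mapD[OF polar_linear_right[of u]]
    by (auto intro!: linear_mapI simp: polar R.l_distr R.m_assoc)
qed (auto simp: base_norm_def q_smult R.m_assoc)

lemma q_eq_base_norm: "x \<in> carrier V \<Longrightarrow> q x = alg_form K (base_norm K q e) (q e) x"
  by (simp add: alg_form_def base_norm_def R.m_lcomm[of "q e"])

section \<open>Regular representations and the spiration algebras\<close>

abbreviation "\<L> \<equiv> left_rep K V q T e"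
abbreviation "\<R> \<equiv> right_rep K V q T e"

lemma left_rep_eq: "\<L> v = (\<lambda>x\<in>carrier V. v \<otimes>\<^bsub>B\<^esub> x)"
  by (auto simp: left_rep_def Lop_def)

lemma right_rep_eq: "\<R> v = (\<lambda>x\<in>carrier V. x \<otimes>\<^bsub>B\<^esub> v)"
  by (auto simp: right_rep_def Rop_def)

lemma linear_map_left_rep: "linear_map K V (End_alg K V) \<L>"
  by (auto intro!: linear_mapI ext simp: left_rep_eq T_add T_smult smult_r_distr smult_commute)

lemma linear_map_right_rep: "linear_map K V (End_alg K V) \<R>"
  by (auto intro!: linear_mapI ext simp: right_rep_eq T_add T_smult smult_r_distr smult_commute)

text \<open>Because \<open>e\<close> is a right unit. Evaluation at \<open>e\<close> is therefore a
  left inverse of \<open>\<L>\<close>, which gives injectivity.\<close>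

lemma left_rep_base: "v \<in> carrier V \<Longrightarrow> \<L> v e = v"
  by (simp add: left_rep_eq kirmse_right)

lemma right_rep_base: "v \<in> carrier V \<Longrightarrow> \<R> v e = v"
  by (simp add: right_rep_eq kirmse_left)

lemma Lop_eq_left_rep:
  assumes "x \<in> carrier V" "y \<in> carrier V"
  shows "Lop V T x y = \<L> (q e \<odot>\<^bsub>V\<^esub> (x \<otimes>\<^bsub>B\<^esub> s y))"
  using assms base_triple[of x y]
  by (auto intro!: ext simp: Lop_def left_rep_eq T_smult)

text \<open>By \<open>base_triple\<close> with the variable in the first slot; associativity then
  collects the two fixed factors on the right.\<close>

lemma Rop_eq_right_rep:
  assumes "x \<in> carrier V" "y \<in> carrier V"
  shows "Rop V T x y = \<R> (q e \<odot>\<^bsub>V\<^esub> (s y \<otimes>\<^bsub>B\<^esub> x))"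
  using assms base_triple[of _ y x]
  by (auto intro!: ext simp: Rop_def right_rep_eq T_smult para_assoc)

text \<open>The image of \<open>\<L>\<close> is a submodule that contains the generators. It is the
  least one, since \<open>\<L> v\<close> is \<open>i\<close> times the generator
  \<open>Lop V T v e\<close>.\<close>

lemma carrier_spiration_L: "carrier (spiration_L K V T) = \<L> ` carrier V"
proof -
  have "lin_span K (End_alg K V) {Lop V T x y | x y. x \<in> carrier V \<and> y \<in> carrier V} = \<L> ` carrier V"
    (is "lin_span _ _ ?S = _")
  proof (rule lin_span_eqI)
    show "submodule (\<L> ` carrier V) K (End_alg K V)"
      by (intro linear_map_image_submodule module_axioms module_End_alg linear_map_left_rep)
    show "?S \<subseteq> \<L> ` carrier V"
      by (auto simp: Lop_eq_left_rep)
  next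
    fix G assume G: "submodule G K (End_alg K V)" "?S \<subseteq> G"
    show "\<L> ` carrier V \<subseteq> G"
    proof
      fix f assume "f \<in> \<L> ` carrier V"
      then obtain v where "v \<in> carrier V" "f = i \<odot>\<^bsub>End_alg K V\<^esub> Lop V T v e"
        unfolding left_rep_def by blast
      moreover have "Lop V T v e \<in> G"
        using G(2) \<open>v \<in> carrier V\<close> base_closed by blast
      ultimately show "f \<in> G"
        using submodule.smult_closed[OF G(1)] i_closed by blast
    qed
  qed
  then show ?thesis
    by (simp add: spiration_L_def)
qed

lemma carrier_spiration_R: "carrier (spiration_R K V T) = \<R> ` carrier V"
proof -
  have "lin_span K (End_alg K V) {Rop V T x y | x y. x \<in> carrier V \<and> y \<in> carrier V} = \<R> ` carrier V"
    (is "lin_span _ _ ?S = _")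
  proof (rule lin_span_eqI)
    show "submodule (\<R> ` carrier V) K (End_alg K V)"
      by (intro linear_map_image_submodule module_axioms module_End_alg linear_map_right_rep)
    show "?S \<subseteq> \<R> ` carrier V"
      by (auto simp: Rop_eq_right_rep)
  next
    fix G assume G: "submodule G K (End_alg K V)" "?S \<subseteq> G"
    show "\<R> ` carrier V \<subseteq> G"
    proof
      fix f assume "f \<in> \<R> ` carrier V"
      then obtain v where "v \<in> carrier V" "f = i \<odot>\<^bsub>End_alg K V\<^esub> Rop V T v e"
        unfolding right_rep_def by blast
      moreover have "Rop V T v e \<in> G"
        using G(2) \<open>v \<in> carrier V\<close> base_closed by blast
      ultimately show "f \<in> G"
        using submodule.smult_closed[OF G(1)] i_closed by blast
    qed
  qed
  then show ?thesis
    by (simp add: spiration_R_def)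
qed

text \<open>Evaluation at \<open>e\<close> gives injectivity, the description of the span gives
  surjectivity, and multiplicativity is associativity of \<open>B\<close>.\<close>

lemma left_rep_algebra_iso: "\<L> \<in> algebra_iso K B (spiration_L K V T)"
proof -
  have "inj_on \<L> (carrier V)"
    by (rule inj_on_inverseI[where g = "\<lambda>f. f e"]) (rule left_rep_base)
  then have bij: "bij_betw \<L> (carrier B) (carrier (spiration_L K V T))"
    by (simp add: bij_betw_def carrier_spiration_L)
  have "\<L> (x \<otimes>\<^bsub>B\<^esub> y) = compose (carrier V) (\<L> x) (\<L> y)"
    if "x \<in> carrier V" "y \<in> carrier V" for x y
    using that by (auto intro!: ext simp: compose_def left_rep_eq T_smult para_assoc)
  moreover have "\<L> e = (\<lambda>v\<in>carrier V. v)"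
    by (auto intro!: ext simp: left_rep_eq kirmse_left)
  ultimately have "\<L> \<in> ring_hom B (spiration_L K V T)"
    using linear_mapD(2)[OF linear_map_left_rep]
    by (intro ring_hom_memI) (simp_all add: carrier_spiration_L del: base_alg_simps(6))
  moreover have "\<L> (c \<odot>\<^bsub>B\<^esub> x) = c \<odot>\<^bsub>spiration_L K V T\<^esub> \<L> x"
    if "c \<in> carrier K" "x \<in> carrier B" for c x
    using that linear_mapD(3)[OF linear_map_left_rep] by simp
  ultimately show ?thesis
    using bij by (simp add: algebra_iso_def ring_iso_def)
qed

text \<open>Right translation by a product composes the translations in reverse order. The
  anti-isomorphism is thus encoded as an isomorphism onto the opposite algebra.\<close>

lemma right_rep_algebra_iso: "\<R> \<in> algebra_iso K B (opposite_alg (spiration_R K V T))"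
proof -
  have "inj_on \<R> (carrier V)"
    by (rule inj_on_inverseI[where g = "\<lambda>f. f e"]) (rule right_rep_base)
  then have bij: "bij_betw \<R> (carrier B) (carrier (opposite_alg (spiration_R K V T)))"
    by (simp add: bij_betw_def carrier_spiration_R)
  have "\<R> (x \<otimes>\<^bsub>B\<^esub> y) = compose (carrier V) (\<R> y) (\<R> x)"
    if "x \<in> carrier V" "y \<in> carrier V" for x y
    using that by (auto intro!: ext simp: compose_def right_rep_eq T_smult para_assoc)
  moreover have "\<R> e = (\<lambda>v\<in>carrier V. v)"
    by (auto intro!: ext simp: right_rep_eq kirmse_right)
  ultimately have "\<R> \<in> ring_hom B (opposite_alg (spiration_R K V T))"
    using linear_mapD(2)[OF linear_map_right_rep]
    by (intro ring_hom_memI) (simp_all add: carrier_spiration_R del: base_alg_simps(6))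
  moreover have "\<R> (c \<odot>\<^bsub>B\<^esub> x) = c \<odot>\<^bsub>opposite_alg (spiration_R K V T)\<^esub> \<R> x"
    if "c \<in> carrier K" "x \<in> carrier B" for c x
    using that linear_mapD(3)[OF linear_map_right_rep] by simp
  ultimately show ?thesis
    using bij by (simp add: algebra_iso_def ring_iso_def)
qed

section \<open>Invertible elements and the skew-field criterion\<close>

lemma Units_base_alg:
  assumes "ternary_composition K V q T"
  shows "Units B = vtimes K V q"
proof (intro equalityI subsetI)
  fix x assume "x \<in> Units B"
  then obtain y where x: "x \<in> carrier V" and y: "y \<in> carrier V" and "x \<otimes>\<^bsub>B\<^esub> y = e"
    by (auto simp: Units_def)
  then have "T x e y = q e \<odot>\<^bsub>V\<^esub> e"
    using scalar_cancel(2)[of "T x e y"] by simp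
  moreover have "q (T x e y) = q x \<otimes> (q e \<otimes> q y)"
    using assms x y by (simp add: ternary_composition_def R.m_assoc)
  \<comment> \<open>Applying \<open>q\<close> to \<open>T x e y = q e \<odot> e\<close> shows that
    this product is the cube of \<open>q e\<close>.\<close>
  ultimately have unit: "q x \<otimes> (q e \<otimes> q y) \<in> Units K"
    by (metis R.Units_m_closed base_closed q_base_Unit q_smult q_mem)
  \<comment> \<open>A factor of a unit in a commutative ring is a unit: \<open>w\<close> is the
    cofactor of \<open>q x\<close> divided by the whole product.\<close>
  define w where "w = (q e \<otimes> q y) \<otimes> inv (q x \<otimes> (q e \<otimes> q y))"
  have w: "w \<in> carrier K" and "q x \<otimes> w = \<one>"
    using x y unit R.Units_r_inv[OF unit]
      R.m_assoc[of "q x" "q e \<otimes> q y" "inv (q x \<otimes> (q e \<otimes> q y))"]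
    by (simp_all add: w_def)
  moreover have "w \<otimes> q x = q x \<otimes> w" and "q x \<in> carrier K"
    using w x by (simp_all add: R.m_comm)
  ultimately have "q x \<in> Units K"
    unfolding Units_def by auto
  then show "x \<in> vtimes K V q"
    using x by (simp add: vtimes_def)
next
  fix x assume "x \<in> vtimes K V q"
  then have x: "x \<in> carrier V" and qx: "q x \<in> Units K"
    by (auto simp: vtimes_def)
  \<comment> \<open>This is \<open>s x\<close> divided by the norm of \<open>x\<close>, which equals
    \<open>q x \<otimes> i\<close>.\<close>
  define y where "y = (q e \<otimes> inv q x) \<odot>\<^bsub>V\<^esub> s x"
  have sx: "s x \<in> carrier V" and c: "q e \<otimes> inv q x \<in> carrier K"
    using x qx by simp_all
  have "(q e \<otimes> inv q x) \<otimes> base_norm K q e x = (q e \<otimes> i) \<otimes> (q x \<otimes> inv q x)"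
    unfolding base_norm_def using x qx
    by (simp only: R.m_ac R.m_closed R.Units_closed R.Units_inv_closed q_base_Unit)
  then have cN: "(q e \<otimes> inv q x) \<odot>\<^bsub>V\<^esub> (base_norm K q e x \<odot>\<^bsub>V\<^esub> e) = e"
    using c x qx by (simp add: base_norm_closed flip: smult_assoc1)
  have "x \<otimes>\<^bsub>B\<^esub> y = (q e \<otimes> inv q x) \<odot>\<^bsub>V\<^esub> (x \<otimes>\<^bsub>B\<^esub> s x)"
    "y \<otimes>\<^bsub>B\<^esub> x = (q e \<otimes> inv q x) \<odot>\<^bsub>V\<^esub> (s x \<otimes>\<^bsub>B\<^esub> x)"
    unfolding y_def using x sx c
      linear_mapD(3)[OF mult_base_linear(2)[OF x] c] linear_mapD(3)[OF mult_base_linear(1)[OF x] c]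
    by (simp_all only: base_alg_simps(1,4))
  then have "x \<otimes>\<^bsub>B\<^esub> y = e" "y \<otimes>\<^bsub>B\<^esub> x = e"
    by (simp_all only: mult_base_sharp[OF x] cN)
  moreover have "y \<in> carrier V"
    using x qx by (simp add: y_def)
  ultimately show "x \<in> Units B"
    using x by (auto simp: Units_def)
qed

text \<open>Since the units of \<open>B\<close> are the vectors in \<open>vtimes K V q\<close>, both
  sides state the same set equation. What remains is that the unit \<open>e\<close> is nonzero:
  \<open>q\<close> vanishes at zero but is invertible at \<open>e\<close>.\<close>

lemma anisotropic_iff_skew_field:
  assumes tc: "ternary_composition K V q T" and nontriv: "\<zero> \<noteq> \<one>"
  shows "anisotropic K V q \<longleftrightarrow> skew_field B"
proof -
  have "q \<zero>\<^bsub>V\<^esub> = \<zero>"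
    using q_smult[of \<zero> "\<zero>\<^bsub>V\<^esub>"] by simp
  moreover have "q e \<noteq> \<zero>"
    using R.Units_r_inv[OF q_base_Unit] R.l_null[OF i_closed] nontriv by metis
  ultimately have "e \<noteq> \<zero>\<^bsub>V\<^esub>"
    by metis
  then show ?thesis
    by (auto simp: anisotropic_def skew_field_def ring_base_alg Units_base_alg[OF tc])
qed

end

section \<open>The triple product of a composition algebra\<close>

text \<open>Associativity comes from \<open>ring A\<close>, as \<open>composition_algebra\<close>
  does not contain it. Faithfulness allows properties of \<open>N\<close> to be read off from
  multiples of the unit.\<close>

locale scaled_composition_algebra = composition_algebra K A sharp
  for K (structure) and A (structure) and sharp +
  fixes N l
  assumes assoc: "ring A"
    and faithful: "faithful_module K A"
    and norm: "is_norm K A sharp N"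
    and l_Unit [simp]: "l \<in> Units K"
begin

abbreviation "q \<equiv> alg_form K N l"
abbreviation "T \<equiv> alg_triple A sharp l"

lemma l_closed [simp]: "l \<in> carrier K"
  by (rule R.Units_closed[OF l_Unit])

lemma mult_closed [simp]: "x \<in> carrier A \<Longrightarrow> y \<in> carrier A \<Longrightarrow> x \<otimes>\<^bsub>A\<^esub> y \<in> carrier A"
  using linear_mapD(1)[OF mult_linear_left] by simp

lemma mult_assoc:
  "x \<in> carrier A \<Longrightarrow> y \<in> carrier A \<Longrightarrow> z \<in> carrier A \<Longrightarrow>
    x \<otimes>\<^bsub>A\<^esub> y \<otimes>\<^bsub>A\<^esub> z = x \<otimes>\<^bsub>A\<^esub> (y \<otimes>\<^bsub>A\<^esub> z)"
  using assoc by (simp add: ring_def monoid.m_assoc)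

lemma mult_distrib:
  assumes "x \<in> carrier A" "x' \<in> carrier A" "y \<in> carrier A"
  shows "(x \<oplus>\<^bsub>A\<^esub> x') \<otimes>\<^bsub>A\<^esub> y = x \<otimes>\<^bsub>A\<^esub> y \<oplus>\<^bsub>A\<^esub> x' \<otimes>\<^bsub>A\<^esub> y"
    and "y \<otimes>\<^bsub>A\<^esub> (x \<oplus>\<^bsub>A\<^esub> x') = y \<otimes>\<^bsub>A\<^esub> x \<oplus>\<^bsub>A\<^esub> y \<otimes>\<^bsub>A\<^esub> x'"
  using assms linear_mapD(2)[OF mult_linear_left] linear_mapD(2)[OF mult_linear_right] by simp_all

lemma mult_smult:
  assumes "c \<in> carrier K" "x \<in> carrier A" "y \<in> carrier A"
  shows "(c \<odot>\<^bsub>A\<^esub> x) \<otimes>\<^bsub>A\<^esub> y = c \<odot>\<^bsub>A\<^esub> (x \<otimes>\<^bsub>A\<^esub> y)"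
    and "y \<otimes>\<^bsub>A\<^esub> (c \<odot>\<^bsub>A\<^esub> x) = c \<odot>\<^bsub>A\<^esub> (y \<otimes>\<^bsub>A\<^esub> x)"
  using assms linear_mapD(3)[OF mult_linear_left] linear_mapD(3)[OF mult_linear_right] by simp_all

lemma sharp_closed [simp]: "x \<in> carrier A \<Longrightarrow> sharp x \<in> carrier A"
  using linear_mapD(1)[OF sharp_linear] .

lemmas sharp_add = linear_mapD(2)[OF sharp_linear]
lemmas sharp_smult = linear_mapD(3)[OF sharp_linear]

text \<open>Apply \<open>sharp\<close> to the product of \<open>sharp\<close> of the unit with the
  unit: one side becomes the unit itself, the other its image under \<open>sharp\<close>.\<close>

lemma sharp_one: "sharp \<one>\<^bsub>A\<^esub> = \<one>\<^bsub>A\<^esub>"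
  using sharp_mult[of "sharp \<one>\<^bsub>A\<^esub>" "\<one>\<^bsub>A\<^esub>"]
  by (simp add: one_mem one_left one_right sharp_sharp)

section \<open>Arithmetic of the norm\<close>

lemma N_closed [simp]: "x \<in> carrier A \<Longrightarrow> N x \<in> carrier K"
  using norm by (auto simp: is_norm_def)

lemma mult_sharp: "x \<in> carrier A \<Longrightarrow> x \<otimes>\<^bsub>A\<^esub> sharp x = N x \<odot>\<^bsub>A\<^esub> \<one>\<^bsub>A\<^esub>"
  using norm by (simp add: is_norm_def)

text \<open>Since \<open>sharp x\<close> is \<open>-x\<close> up to a scalar, it commutes with \<open>x\<close>.\<close>

lemma sharp_mult_self:
  assumes x: "x \<in> carrier A"
  shows "sharp x \<otimes>\<^bsub>A\<^esub> x = N x \<odot>\<^bsub>A\<^esub> \<one>\<^bsub>A\<^esub>"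
proof -
  obtain c where c: "c \<in> carrier K" "x \<oplus>\<^bsub>A\<^esub> sharp x = c \<odot>\<^bsub>A\<^esub> \<one>\<^bsub>A\<^esub>"
    using trace_scalar[OF x] by blast
  have "x \<otimes>\<^bsub>A\<^esub> (x \<oplus>\<^bsub>A\<^esub> sharp x) = (x \<oplus>\<^bsub>A\<^esub> sharp x) \<otimes>\<^bsub>A\<^esub> x"
    using x c(1) by (simp add: c(2) mult_smult one_mem one_left one_right)
  then have "sharp x \<otimes>\<^bsub>A\<^esub> x = x \<otimes>\<^bsub>A\<^esub> sharp x"
    using x by (simp add: mult_distrib)
  then show ?thesis
    using x by (simp add: mult_sharp)
qed

text \<open>The action of a scalar on \<open>v\<close> is multiplication by its multiple of the
  unit, so agreement at the unit spreads to all of \<open>A\<close>. The norm identities below are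
  checked in this way.\<close>

lemma scalar_eqI:
  assumes "c \<in> carrier K" "d \<in> carrier K" "c \<odot>\<^bsub>A\<^esub> \<one>\<^bsub>A\<^esub> = d \<odot>\<^bsub>A\<^esub> \<one>\<^bsub>A\<^esub>"
  shows "c = d"
proof (rule faithful_eqI[OF faithful assms(1,2)])
  fix v assume "v \<in> carrier A"
  then show "c \<odot>\<^bsub>A\<^esub> v = d \<odot>\<^bsub>A\<^esub> v"
    using assms mult_smult(1)[of c "\<one>\<^bsub>A\<^esub>" v] mult_smult(1)[of d "\<one>\<^bsub>A\<^esub>" v]
    by (simp add: one_mem one_left)
qed

lemma N_one: "N \<one>\<^bsub>A\<^esub> = \<one>"
  using mult_sharp[of "\<one>\<^bsub>A\<^esub>"] by (intro scalar_eqI) (simp_all add: one_mem one_left sharp_one)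

text \<open>The norm of \<open>sharp x\<close> is read off from \<open>sharp x\<close> times
  \<open>x\<close>, which \<open>sharp_mult_self\<close> evaluates.\<close>

lemma N_sharp: "x \<in> carrier A \<Longrightarrow> N (sharp x) = N x"
  using mult_sharp[of "sharp x"] by (intro scalar_eqI) (simp_all add: sharp_sharp sharp_mult_self)

lemma N_smult:
  assumes "c \<in> carrier K" "x \<in> carrier A"
  shows "N (c \<odot>\<^bsub>A\<^esub> x) = c \<otimes> c \<otimes> N x"
  using assms mult_sharp[of "c \<odot>\<^bsub>A\<^esub> x"]
  by (intro scalar_eqI) (simp_all add: mult_smult sharp_smult mult_sharp smult_assoc1 one_mem)

text \<open>After reversing with \<open>sharp\<close>, the inner product of \<open>y\<close> and
  \<open>sharp y\<close> is a scalar and can be pulled out.\<close>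

lemma N_mult:
  assumes "x \<in> carrier A" "y \<in> carrier A"
  shows "N (x \<otimes>\<^bsub>A\<^esub> y) = N x \<otimes> N y"
proof (rule scalar_eqI)
  have "N (x \<otimes>\<^bsub>A\<^esub> y) \<odot>\<^bsub>A\<^esub> \<one>\<^bsub>A\<^esub> = x \<otimes>\<^bsub>A\<^esub> (y \<otimes>\<^bsub>A\<^esub> sharp y \<otimes>\<^bsub>A\<^esub> sharp x)"
    using assms mult_sharp[of "x \<otimes>\<^bsub>A\<^esub> y"] by (simp add: sharp_mult mult_assoc)
  also have "\<dots> = N y \<odot>\<^bsub>A\<^esub> (N x \<odot>\<^bsub>A\<^esub> \<one>\<^bsub>A\<^esub>)"
    using assms by (simp add: mult_sharp mult_smult one_mem one_left)
  also have "\<dots> = (N x \<otimes> N y) \<odot>\<^bsub>A\<^esub> \<one>\<^bsub>A\<^esub>"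
    using assms by (simp add: smult_assoc1 smult_commute one_mem)
  finally show "N (x \<otimes>\<^bsub>A\<^esub> y) \<odot>\<^bsub>A\<^esub> \<one>\<^bsub>A\<^esub> = (N x \<otimes> N y) \<odot>\<^bsub>A\<^esub> \<one>\<^bsub>A\<^esub>" .
qed (use assms in simp_all)

section \<open>The scaled norm as a quadratic form\<close>

lemma alg_form_closed [simp]: "x \<in> carrier A \<Longrightarrow> q x \<in> carrier K"
  by (simp add: alg_form_def)

lemma alg_form_smult_one: "x \<in> carrier A \<Longrightarrow> q x \<odot>\<^bsub>A\<^esub> \<one>\<^bsub>A\<^esub> = l \<odot>\<^bsub>A\<^esub> (x \<otimes>\<^bsub>A\<^esub> sharp x)"
  by (simp add: alg_form_def mult_sharp smult_assoc1 one_mem)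

lemma polar_alg_form_closed [simp]:
  "u \<in> carrier A \<Longrightarrow> v \<in> carrier A \<Longrightarrow> polar K A q u v \<in> carrier K"
  by (simp add: polar_def)

text \<open>Expanding the scaled product of \<open>u \<oplus> v\<close> with its image under
  \<open>sharp\<close>, the diagonal terms cancel and the mixed ones remain. Bilinearity of the
  polar form thus becomes a computation in \<open>A\<close>.\<close>

lemma polar_smult_one:
  assumes u: "u \<in> carrier A" and v: "v \<in> carrier A"
  shows "polar K A q u v \<odot>\<^bsub>A\<^esub> \<one>\<^bsub>A\<^esub> =
    l \<odot>\<^bsub>A\<^esub> (u \<otimes>\<^bsub>A\<^esub> sharp v) \<oplus>\<^bsub>A\<^esub> l \<odot>\<^bsub>A\<^esub> (v \<otimes>\<^bsub>A\<^esub> sharp u)"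
proof -
  let ?a = "l \<odot>\<^bsub>A\<^esub> (u \<otimes>\<^bsub>A\<^esub> sharp u)" and ?b = "l \<odot>\<^bsub>A\<^esub> (v \<otimes>\<^bsub>A\<^esub> sharp v)"
  let ?c = "l \<odot>\<^bsub>A\<^esub> (u \<otimes>\<^bsub>A\<^esub> sharp v)" and ?d = "l \<odot>\<^bsub>A\<^esub> (v \<otimes>\<^bsub>A\<^esub> sharp u)"
  have "polar K A q u v \<odot>\<^bsub>A\<^esub> \<one>\<^bsub>A\<^esub>
      = l \<odot>\<^bsub>A\<^esub> ((u \<oplus>\<^bsub>A\<^esub> v) \<otimes>\<^bsub>A\<^esub> sharp (u \<oplus>\<^bsub>A\<^esub> v)) \<oplus>\<^bsub>A\<^esub> \<ominus>\<^bsub>A\<^esub> ?a \<oplus>\<^bsub>A\<^esub> \<ominus>\<^bsub>A\<^esub> ?b"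
    using u v by (simp add: polar_def R.minus_eq smult_l_distr smult_l_minus one_mem
        alg_form_smult_one)
  also have "\<dots> = (?c \<oplus>\<^bsub>A\<^esub> ?d) \<oplus>\<^bsub>A\<^esub> (?a \<oplus>\<^bsub>A\<^esub> \<ominus>\<^bsub>A\<^esub> ?a) \<oplus>\<^bsub>A\<^esub> (?b \<oplus>\<^bsub>A\<^esub> \<ominus>\<^bsub>A\<^esub> ?b)"
  proof -
    have "l \<odot>\<^bsub>A\<^esub> ((u \<oplus>\<^bsub>A\<^esub> v) \<otimes>\<^bsub>A\<^esub> sharp (u \<oplus>\<^bsub>A\<^esub> v)) = ?a \<oplus>\<^bsub>A\<^esub> ?d \<oplus>\<^bsub>A\<^esub> (?c \<oplus>\<^bsub>A\<^esub> ?b)"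
      using u v by (simp add: sharp_add mult_distrib smult_r_distr)
    then show ?thesis
      using u v by (simp only: M.a_ac M.a_closed M.a_inv_closed smult_closed mult_closed
          sharp_closed l_closed)
  qed
  also have "\<dots> = ?c \<oplus>\<^bsub>A\<^esub> ?d"
    using u v by (simp add: M.r_neg)
  finally show ?thesis .
qed

lemma quadratic_space_alg_form: "quadratic_space K A q"
proof (intro quadratic_space.intro module_axioms quadratic_space_axioms.intro)
  show "q \<in> carrier A \<rightarrow> carrier K"
    by simp
  show "q (c \<odot>\<^bsub>A\<^esub> v) = c \<otimes> c \<otimes> q v" if "c \<in> carrier K" "v \<in> carrier A" for c v
    using that by (simp add: alg_form_def N_smult R.m_lcomm[of l] R.m_assoc)
  show left: "linear_map K A (regular_module K) (\<lambda>u. polar K A q u v)" if "v \<in> carrier A" for v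
    using that
    by (auto intro!: linear_mapI scalar_eqI simp: polar_smult_one smult_l_distr smult_assoc1
        one_mem mult_distrib mult_smult sharp_add sharp_smult smult_r_distr smult_commute M.a_ac)
  \<comment> \<open>The two mixed terms are exchanged by swapping \<open>u\<close> and
    \<open>v\<close>; linearity in the second argument then follows from the first.\<close>
  have "polar K A q u v = polar K A q v u" if "u \<in> carrier A" "v \<in> carrier A" for u v
    using that by (auto intro!: scalar_eqI simp: polar_smult_one M.a_comm)
  then show "linear_map K A (regular_module K) (\<lambda>v. polar K A q u v)" if "u \<in> carrier A" for u
    using that left[OF that] by (simp add: linear_map_def Pi_iff)
qed

text \<open>With the unit as base point, division by \<open>q e\<close> therefore cancels exactly
  the scaling by \<open>l\<close>.\<close>

lemma alg_form_one: "q \<one>\<^bsub>A\<^esub> = l"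
  by (simp add: alg_form_def N_one)

lemma one_vtimes: "\<one>\<^bsub>A\<^esub> \<in> vtimes K A q"
  by (simp add: vtimes_def one_mem alg_form_one)

text \<open>The Kirmse laws are the two norm equations. For para-associativity, \<open>sharp\<close>
  reverses the inner product, so all bracketings give the same alternating product times the square
  of \<open>l\<close>. In the composition law both sides carry the cube of \<open>l\<close>.\<close>

lemma group_spherical_space_alg_triple: "group_spherical_space K A q T"
proof (intro group_spherical_space.intro kirmse_para_space.intro quadratic_space_alg_form
    kirmse_para_space_axioms.intro group_spherical_space_axioms.intro)
  show "vtimes K A q \<noteq> {}"
    using one_vtimes by blast
  show "ternary_composition K A q T"
    unfolding ternary_composition_def
    by (simp add: alg_form_def alg_triple_def N_smult N_mult N_sharp R.m_ac)
  fix x y z assume "x \<in> carrier A" "y \<in> carrier A"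
  then show "T x x y = q x \<odot>\<^bsub>A\<^esub> y" "T y x x = q x \<odot>\<^bsub>A\<^esub> y"
    by (simp_all add: alg_triple_def alg_form_def mult_sharp sharp_mult_self mult_assoc mult_smult
        one_mem one_left one_right smult_assoc1)
qed (auto intro!: linear_mapI simp: alg_triple_def mult_distrib mult_smult sharp_add sharp_smult
    sharp_mult sharp_sharp mult_assoc smult_r_distr smult_commute)

section \<open>Recovering the algebra from its triple product\<close>

lemma base_alg_alg_triple:
  assumes "x \<in> carrier A" "z \<in> carrier A"
  shows "x \<otimes>\<^bsub>base_alg K A q T \<one>\<^bsub>A\<^esub>\<^esub> z = x \<otimes>\<^bsub>A\<^esub> z"
  using assms
  by (simp add: base_alg_def alg_triple_def alg_form_one sharp_one one_mem one_right
      flip: smult_assoc1)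

lemma base_sharp_alg_triple:
  assumes "x \<in> carrier A"
  shows "base_sharp K A q T \<one>\<^bsub>A\<^esub> x = sharp x"
  using assms
  by (simp add: base_sharp_def Sop_def alg_triple_def alg_form_one one_mem one_left one_right
      flip: smult_assoc1)

text \<open>The value at the unit is rewritten to \<open>l\<close> before \<open>alg_form\<close> is
  unfolded, so that the inverse stays that of \<open>l\<close>.\<close>

lemma base_norm_alg_form: "x \<in> carrier A \<Longrightarrow> base_norm K q \<one>\<^bsub>A\<^esub> x = N x"
  by (simp add: base_norm_def alg_form_one) (simp add: alg_form_def R.m_comm[of l] R.m_assoc)

end

section \<open>Assembly of both directions and of the composition law\<close>

theorem theorem4p13:
  fixes K :: "('k, 'r) ring_scheme"
    and A :: "('k, 'a, 'm) module_scheme"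
    and V :: "('k, 'v, 'n) module_scheme"
  shows
    "(\<forall>sharp N l.
        composition_algebra K A sharp \<and> ring A \<and> faithful_module K A \<and>
        is_norm K A sharp N \<and> l \<in> Units K \<longrightarrow>
          group_spherical_space K A (alg_form K N l) (alg_triple A sharp l) \<and>
          (let q = alg_form K N l; T = alg_triple A sharp l; e = \<one>\<^bsub>A\<^esub> in
             e \<in> vtimes K A q \<and> q e = l \<and>
             (\<forall>x\<in>carrier A. \<forall>z\<in>carrier A. x \<otimes>\<^bsub>base_alg K A q T e\<^esub> z = x \<otimes>\<^bsub>A\<^esub> z) \<and>
             (\<forall>x\<in>carrier A. base_sharp K A q T e x = sharp x) \<and>
             (\<forall>x\<in>carrier A. base_norm K q e x = N x)))
     \<and>
     (\<forall>q T e.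
        group_spherical_space K V q T \<and> e \<in> vtimes K V q \<longrightarrow>
          (let B = base_alg K V q T e; s = base_sharp K V q T e; N = base_norm K q e in
             (composition_algebra K B s \<and> ring B \<and> \<one>\<^bsub>B\<^esub> = e \<and>
              (\<forall>x\<in>carrier V. s x = inv\<^bsub>K\<^esub> (q e) \<odot>\<^bsub>V\<^esub> T e x e \<and>
                 s x = ((polar K V q x e \<otimes>\<^bsub>K\<^esub> inv\<^bsub>K\<^esub> (q e)) \<odot>\<^bsub>V\<^esub> e) \<ominus>\<^bsub>V\<^esub> x) \<and>
              quadratic_space K B N \<and> is_norm K B s N)
             \<and>
             ((\<forall>x\<in>carrier V. \<forall>y\<in>carrier V. \<forall>z\<in>carrier V.
                 T x y z = alg_triple B s (q e) x y z \<and>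
                 T x y z = q e \<odot>\<^bsub>V\<^esub> (x \<otimes>\<^bsub>B\<^esub> s y \<otimes>\<^bsub>B\<^esub> z)) \<and>
              (\<forall>x\<in>carrier V. q x = alg_form K N (q e) x))
             \<and>
             (left_rep K V q T e \<in> algebra_iso K B (spiration_L K V T) \<and>
              (\<forall>v\<in>carrier V. left_rep K V q T e v e = v) \<and>
              (\<forall>f\<in>carrier (spiration_L K V T). f e \<in> carrier V \<and> left_rep K V q T e (f e) = f))
             \<and>
             (right_rep K V q T e \<in> algebra_iso K B (opposite_alg (spiration_R K V T)) \<and>
              (\<forall>v\<in>carrier V. right_rep K V q T e v e = v) \<and>
              (\<forall>f\<in>carrier (spiration_R K V T). f e \<in> carrier V \<and> right_rep K V q T e (f e) = f))
             \<and>
             (field K \<longrightarrow> (anisotropic K V q \<longleftrightarrow> skew_field B))))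
     \<and>
     (\<forall>q T. kirmse_para_space K V q T \<and> faithful_module K V \<longrightarrow> ternary_composition K V q T)"
proof (intro conjI allI impI)
  fix sharp N l
  assume A: "composition_algebra K A sharp \<and> ring A \<and> faithful_module K A \<and>
    is_norm K A sharp N \<and> l \<in> Units K"
  interpret scaled_composition_algebra K A sharp N l
    using A by (intro scaled_composition_algebra.intro scaled_composition_algebra_axioms.intro) simp_all
  show "group_spherical_space K A (alg_form K N l) (alg_triple A sharp l)"
    by (rule group_spherical_space_alg_triple)
  show "let q = alg_form K N l; T = alg_triple A sharp l; e = \<one>\<^bsub>A\<^esub> in
      e \<in> vtimes K A q \<and> q e = l \<and>
      (\<forall>x\<in>carrier A. \<forall>z\<in>carrier A. x \<otimes>\<^bsub>base_alg K A q T e\<^esub> z = x \<otimes>\<^bsub>A\<^esub> z) \<and>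
      (\<forall>x\<in>carrier A. base_sharp K A q T e x = sharp x) \<and>
      (\<forall>x\<in>carrier A. base_norm K q e x = N x)"
    by (simp add: Let_def one_vtimes alg_form_one base_alg_alg_triple base_sharp_alg_triple
        base_norm_alg_form)
next
  fix q T e
  assume V: "group_spherical_space K V q T \<and> e \<in> vtimes K V q"
  then interpret group_spherical_space K V q T
    by simp
  interpret pointed_kirmse_space K V q T e
    using V by (intro pointed_kirmse_space.intro pointed_kirmse_space_axioms.intro
        kirmse_para_space_axioms) simp
  have field: "anisotropic K V q \<longleftrightarrow> skew_field B" if "field K"
    using that domain.zero_not_one[of K] by (intro anisotropic_iff_skew_field ternary_comp)
      (simp add: field_def)
  show "let B = base_alg K V q T e; s = base_sharp K V q T e; N = base_norm K q e in
     (composition_algebra K B s \<and> ring B \<and> \<one>\<^bsub>B\<^esub> = e \<and>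
      (\<forall>x\<in>carrier V. s x = inv\<^bsub>K\<^esub> (q e) \<odot>\<^bsub>V\<^esub> T e x e \<and>
         s x = ((polar K V q x e \<otimes>\<^bsub>K\<^esub> inv\<^bsub>K\<^esub> (q e)) \<odot>\<^bsub>V\<^esub> e) \<ominus>\<^bsub>V\<^esub> x) \<and>
      quadratic_space K B N \<and> is_norm K B s N)
     \<and>
     ((\<forall>x\<in>carrier V. \<forall>y\<in>carrier V. \<forall>z\<in>carrier V.
         T x y z = alg_triple B s (q e) x y z \<and>
         T x y z = q e \<odot>\<^bsub>V\<^esub> (x \<otimes>\<^bsub>B\<^esub> s y \<otimes>\<^bsub>B\<^esub> z)) \<and>
      (\<forall>x\<in>carrier V. q x = alg_form K N (q e) x))
     \<and>
     (left_rep K V q T e \<in> algebra_iso K B (spiration_L K V T) \<and>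
      (\<forall>v\<in>carrier V. left_rep K V q T e v e = v) \<and>
      (\<forall>f\<in>carrier (spiration_L K V T). f e \<in> carrier V \<and> left_rep K V q T e (f e) = f))
     \<and>
     (right_rep K V q T e \<in> algebra_iso K B (opposite_alg (spiration_R K V T)) \<and>
      (\<forall>v\<in>carrier V. right_rep K V q T e v e = v) \<and>
      (\<forall>f\<in>carrier (spiration_R K V T). f e \<in> carrier V \<and> right_rep K V q T e (f e) = f))
     \<and>
     (field K \<longrightarrow> (anisotropic K V q \<longleftrightarrow> skew_field B))"
    unfolding Let_def
  proof (intro conjI ballI impI)
    fix x assume "x \<in> carrier V"
    then show "s x = inv\<^bsub>K\<^esub> (q e) \<odot>\<^bsub>V\<^esub> T e x e"
      "s x = ((polar K V q x e \<otimes>\<^bsub>K\<^esub> inv\<^bsub>K\<^esub> (q e)) \<odot>\<^bsub>V\<^esub> e) \<ominus>\<^bsub>V\<^esub> x"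
      "q x = alg_form K (base_norm K q e) (q e) x" "\<L> x e = x" "\<R> x e = x"
      by (rule base_sharp_eq base_sharp_eq_reflection q_eq_base_norm left_rep_base right_rep_base)+
    fix y z assume "y \<in> carrier V" "z \<in> carrier V"
    with \<open>x \<in> carrier V\<close> show "T x y z = q e \<odot>\<^bsub>V\<^esub> (x \<otimes>\<^bsub>B\<^esub> s y \<otimes>\<^bsub>B\<^esub> z)"
      by (rule base_triple)
    then show "T x y z = alg_triple B s (q e) x y z"
      by (simp only: alg_triple_def base_alg_simps(4))
  next
    \<comment> \<open>Every such \<open>f\<close> is some \<open>\<L> v\<close>, and evaluation at
      \<open>e\<close> returns \<open>v\<close>; hence evaluation inverts \<open>\<L>\<close> on
      both sides.\<close>
    fix f assume "f \<in> carrier (spiration_L K V T)"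
    then show "f e \<in> carrier V" "\<L> (f e) = f"
      by (auto simp: carrier_spiration_L left_rep_base)
  next
    fix f assume "f \<in> carrier (spiration_R K V T)"
    then show "f e \<in> carrier V" "\<R> (f e) = f"
      by (auto simp: carrier_spiration_R right_rep_base)
  qed (simp_all only: composition_algebra_base_alg ring_base_alg base_alg_simps
      quadratic_space_base_norm is_norm_base_norm left_rep_algebra_iso right_rep_algebra_iso field)
next
  fix q T
  assume "kirmse_para_space K V q T \<and> faithful_module K V"
  then show "ternary_composition K V q T"
    by (simp add: kirmse_para_space.ternary_composition)
qed

end
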